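(* For every $z\in\mathbb{D}^*=\{z\in\mathbb{C}: 0<|z|<1\}$, the limit set $\Lambda_z$ of the semigroup $G_z$ is disconnected if and only if $G_z$ is Schottky.
   Context: For $z\in\mathbb{D}^*$ let $f(x)=zx$ and $g(x)=z(x-1)+1$ be maps $\mathbb{C}\to\mathbb{C}$, and let $G_z$ be the semigroup (under composition) generated by $f$ and $g$. The limit set $\Lambda_z$ is the unique nonempty compact set $\Lambda_z\subseteq\mathbb{C}$ with $\Lambda_z=f(\Lambda_z)\cup g(\Lambda_z)$ (equivalently, the closure of the set of fixed points of elements of $G_z$). A semigroup generated by a finite set $S$ of contracting similarities is called Schottky if there is an embedded loop $\gamma\subseteq\mathbb{C}$ bounding a closed topological disk $D$ such that the elements of $S$ map $D$ to pairwise disjoint disks contained in the interior of $D$. *)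

theory Defs
  imports "HOL-Analysis.Analysis"
begin

definition gen_f :: "complex \<Rightarrow> complex \<Rightarrow> complex" where
  "gen_f z = (\<lambda>x. z * x)"

definition gen_g :: "complex \<Rightarrow> complex \<Rightarrow> complex" where
  "gen_g z = (\<lambda>x. z * (x - 1) + 1)"

definition limit_set :: "complex \<Rightarrow> complex set" where
  "limit_set z = (THE K. K \<noteq> {} \<and> compact K \<and> K = gen_f z ` K \<union> gen_g z ` K)"

definition schottky :: "(complex \<Rightarrow> complex) set \<Rightarrow> bool" where
  "schottky S \<longleftrightarrow> (\<exists>\<gamma> D.
      simple_path \<gamma> \<and> pathfinish \<gamma> = pathstart \<gamma> \<and>
      D homeomorphic cball (0::complex) 1 \<and> path_image \<gamma> = frontier D \<and>
      (\<forall>s\<in>S. s ` D \<subseteq> interior D) \<and>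
      (\<forall>s\<in>S. \<forall>t\<in>S. s \<noteq> t \<longrightarrow> s ` D \<inter> t ` D = {}))"

end

theory Submission
  imports Defs "HOL-Complex_Analysis.Riemann_Mapping"
begin

text \<open>
  Let \<open>\<delta>\<close> be the distance between \<open>f \<Lambda>\<close> and \<open>g \<Lambda>\<close>. Any two points of \<open>\<Lambda>\<close> are joined by hops inside \<open>\<Lambda>\<close>
  whose lengths are at most \<open>\<delta>\<close>: if hops of length \<open>\<epsilon>\<close> suffice, then so do hops of length
  \<open>max (\<bar>z\<bar> \<epsilon>) \<delta>\<close>. Hence the \<open>r\<close>-neighbourhood \<open>U\<close> of \<open>\<Lambda>\<close> is connected for \<open>r > \<delta>/2\<close>, and \<open>\<Lambda>\<close> is
  connected if \<open>\<delta> = 0\<close>. If \<open>\<delta> > 0\<close>, choose \<open>\<delta>/2 < r < \<delta>/(2 \<bar>z\<bar>)\<close>: the images under \<open>f\<close> and \<open>g\<close> of the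
  closure of \<open>U\<close> are disjoint and contained in \<open>U\<close>. They are translates of each other, so neither
  lies in a hole of the other, and they remain disjoint after filling their holes. Filling the holes
  of \<open>U\<close> gives a simply connected domain \<open>W\<close>, and the image under a Riemann map of a large enough
  round disk is a Schottky disk \<open>D \<subseteq> W\<close>. Conversely, such a disk contains \<open>\<Lambda>\<close>, which is
  then separated by \<open>f D\<close> and \<open>g D\<close>.
\<close>

section \<open>The two generators as similarities of the plane\<close>

lemma dist_gen_f: "dist (gen_f z x) (gen_f z y) = norm z * dist x y"
  by (simp add: gen_f_def dist_norm norm_mult flip: right_diff_distrib)

text \<open>In this form the images of a set under the two generators are visibly translates of each
  other by \<open>1 - z\<close>, which later rules out that one image sits in a hole of the
  other.\<close>

lemma gen_g_eq: "gen_g z x = (1 - z) + gen_f z x"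
  by (simp add: gen_f_def gen_g_def algebra_simps)

lemma dist_gen_g: "dist (gen_g z x) (gen_g z y) = norm z * dist x y"
  by (simp add: gen_g_eq dist_gen_f)

lemma continuous_on_gen_f: "continuous_on S (gen_f z)"
  unfolding gen_f_def by (intro continuous_intros)

lemma continuous_on_gen_g: "continuous_on S (gen_g z)"
  unfolding gen_g_def by (intro continuous_intros)

lemma homeomorphism_gen_f:
  assumes "z \<noteq> 0"
  shows "homeomorphism UNIV UNIV (gen_f z) (\<lambda>y. y / z)"
  by (rule homeomorphismI) (use assms in \<open>auto simp: gen_f_def intro!: continuous_intros\<close>)

lemma homeomorphism_gen_g:
  assumes "z \<noteq> 0"
  shows "homeomorphism UNIV UNIV (gen_g z) (\<lambda>y. (y - 1) / z + 1)"
  by (rule homeomorphismI) (use assms in \<open>auto simp: gen_g_def intro!: continuous_intros\<close>)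

lemma image_ball_of_similarity:
  assumes "homeomorphism UNIV UNIV h k" "\<And>x y. dist (h x) (h y) = c * dist x y" "c > 0"
  shows "h ` ball x s = ball (h x) (c * s)"
proof (intro equalityI subsetI)
  fix y assume "y \<in> ball (h x) (c * s)"
  moreover have "y = h (k y)"
    using assms(1) by (simp add: homeomorphism_def)
  ultimately show "y \<in> h ` ball x s"
    by (metis assms(2,3) image_eqI mem_ball mult_less_cancel_left_pos)
qed (use assms(2,3) in auto)


section \<open>The limit set\<close>

text \<open>Pull a point of \<open>K\<close> back \<open>n\<close> times inside \<open>K\<close>,
  then push a point of \<open>L\<close> forward along the same word of generators: the two end
  points are within \<open>norm z ^ n * M\<close>, so the distance to the closed set
  \<open>L\<close> is 0. This serves both for the uniqueness of the limit set and for placing it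
  inside a Schottky disk.\<close>

lemma self_covered_subset_invariant:
  assumes z: "norm z < 1"
    and K: "bounded K" "K \<subseteq> gen_f z ` K \<union> gen_g z ` K"
    and L: "closed L" "L \<noteq> {}" "gen_f z ` L \<union> gen_g z ` L \<subseteq> L"
  shows "K \<subseteq> L"
proof
  fix x assume x: "x \<in> K"
  obtain l where l: "l \<in> L"
    using L by blast
  obtain M where M: "\<And>y. y \<in> K \<Longrightarrow> dist l y \<le> M"
    using K(1) bounded_any_center[of K l] by auto
  have bound: "\<forall>x\<in>K. \<exists>y\<in>L. dist x y \<le> norm z ^ n * M" for n
  proof (induction n)
    case 0
    then show ?case
      using M l by (auto simp: dist_commute)
  next
    case (Suc n)
    show ?case
    proof
      fix x assume "x \<in> K"
      then obtain w where w: "w \<in> K" "x = gen_f z w \<or> x = gen_g z w"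
        using K by blast
      then obtain y where y: "y \<in> L" "dist w y \<le> norm z ^ n * M"
        using Suc by blast
      have "norm z * dist w y \<le> norm z ^ Suc n * M"
        using mult_left_mono[OF y(2) norm_ge_zero[of z]] by (simp add: mult.assoc)
      then have "dist (gen_f z w) (gen_f z y) \<le> norm z ^ Suc n * M"
        "dist (gen_g z w) (gen_g z y) \<le> norm z ^ Suc n * M"
        by (simp_all add: dist_gen_f dist_gen_g)
      moreover have "gen_f z y \<in> L" "gen_g z y \<in> L"
        using L(3) y(1) by auto
      ultimately show "\<exists>y\<in>L. dist x y \<le> norm z ^ Suc n * M"
        using w(2) by blast
    qed
  qed
  have "infdist x L \<le> norm z ^ n * M" for n
    using bound[of n] x infdist_le2 by blast
  moreover have "(\<lambda>n. norm z ^ n * M) \<longlonglongrightarrow> 0"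
    using z by (intro tendsto_mult_left_zero LIMSEQ_power_zero) auto
  ultimately have "infdist x L \<le> 0"
    by (meson LIMSEQ_le_const)
  then show "x \<in> L"
    using L in_closed_iff_infdist_zero infdist_nonneg by (metis order_antisym)
qed

text \<open>Both generators map a large closed disk into itself, so its iterates under the union of
  the two images decrease, and their intersection is the required set.\<close>

lemma exists_self_similar_compact:
  assumes z: "norm z < 1"
  shows "\<exists>K. K \<noteq> {} \<and> compact K \<and> K = gen_f z ` K \<union> gen_g z ` K"
proof -
  \<comment> \<open>\<open>R\<close> solves \<open>norm z * R + norm (1 - z) = R\<close>, the radius
    at which the bound for \<open>gen_g z\<close> closes up.\<close>
  define R where "R = norm (1 - z) / (1 - norm z)"
  define H where "H S = gen_f z ` S \<union> gen_g z ` S" for S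
  define F where "F n = (H ^^ n) (cball 0 R)" for n
  have R: "norm z * R + norm (1 - z) = R" "R \<ge> 0"
    using z by (auto simp: R_def divide_simps) (simp add: algebra_simps)
  have H_mono: "H S \<subseteq> H T" if "S \<subseteq> T" for S T
    using that by (auto simp: H_def)
  have F_Suc: "F (Suc n) = H (F n)" for n
    by (simp add: F_def)
  have "norm (gen_f z x) \<le> R" "norm (gen_g z x) \<le> R" if "norm x \<le> R" for x
  proof -
    have 1: "norm (gen_f z x) \<le> norm z * R"
      using that by (simp add: gen_f_def norm_mult mult_left_mono)
    with R show "norm (gen_f z x) \<le> R"
      by (smt (verit) norm_ge_zero)
    show "norm (gen_g z x) \<le> R"
      unfolding gen_g_eq using 1 R norm_triangle_ineq[of "1 - z" "gen_f z x"] by linarith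
  qed
  then have base: "F (Suc 0) \<subseteq> F 0"
    by (auto simp: F_def H_def)
  have "F (Suc n) \<subseteq> F n" for n
    by (induction n) (use base F_Suc H_mono in auto)
  then have dec: "F n \<subseteq> F m" if "m \<le> n" for m n
    using that lift_Suc_antimono_le[of F] by blast
  have comp: "compact (F n)" for n
    by (induction n)
      (auto simp: F_def H_def intro!: compact_Un compact_continuous_image
        continuous_on_gen_f continuous_on_gen_g)
  have ne: "F n \<noteq> {}" for n
    by (induction n) (use R in \<open>auto simp: F_def H_def\<close>)
  define L where "L = (\<Inter>n. F n)"
  have "L \<noteq> {}"
    unfolding L_def using compact_nest[of F] comp ne dec by blast
  moreover have "compact L"
    unfolding L_def using comp by (intro compact_Inter) auto
  moreover have "H L \<subseteq> L"
  proof -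
    have "H L \<subseteq> F n" for n
    proof -
      have "H L \<subseteq> F (Suc n)"
        unfolding F_Suc by (rule H_mono) (auto simp: L_def)
      then show ?thesis
        using dec[of n "Suc n"] by auto
    qed
    then show ?thesis
      by (auto simp: L_def)
  qed
  moreover have "L \<subseteq> H L"
  proof
    fix x assume x: "x \<in> L"
    show "x \<in> H L"
    proof (cases "z = 0")
      \<comment> \<open>Here the generators are the constants 0 and 1 and have no inverses, but
        every nonempty set has the same image under \<open>H\<close>.\<close>
      case True
      have "x \<in> H (F 0)"
        using x F_Suc unfolding L_def by blast
      with True \<open>L \<noteq> {}\<close> show ?thesis
        by (auto simp: H_def gen_f_def gen_g_def)
    next
      case False
      define a b where "a = x / z" and "b = (x - 1) / z + 1"
      have inv: "y = a" if "x = gen_f z y" for y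
        using that False by (simp add: a_def gen_f_def)
      have inv': "y = b" if "x = gen_g z y" for y
        using that False by (simp add: b_def gen_g_def)
      have ab: "a \<in> F n \<or> b \<in> F n" for n
      proof -
        have "x \<in> H (F n)"
          using x F_Suc unfolding L_def by blast
        then show ?thesis
          using inv inv' by (auto simp: H_def)
      qed
      \<comment> \<open>The only candidate preimages of \<open>x\<close> are \<open>a\<close> and
        \<open>b\<close>. If each missed some \<open>F\<close>, both would miss a common later one,
        because the \<open>F n\<close> decrease.\<close>
      have "a \<in> L \<or> b \<in> L"
      proof (rule ccontr)
        assume "\<not> (a \<in> L \<or> b \<in> L)"
        then obtain m n where "a \<notin> F m" "b \<notin> F n"
          by (auto simp: L_def)
        then show False
          using ab[of "max m n"] dec[of m "max m n"] dec[of n "max m n"] by auto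
      qed
      moreover have "x = gen_f z a" "x = gen_g z b"
        using False by (simp_all add: a_def b_def gen_f_def gen_g_def)
      ultimately show ?thesis
        unfolding H_def by (metis UnI1 UnI2 image_eqI)
    qed
  qed
  ultimately show ?thesis
    unfolding H_def by blast
qed

text \<open>The comparison lemma applied in both directions gives uniqueness, so the definite
  description in \<open>limit_set\<close> really denotes the compact set found above.\<close>

lemma limit_set_properties:
  assumes "norm z < 1"
  shows "limit_set z \<noteq> {}" "compact (limit_set z)"
    and "limit_set z = gen_f z ` limit_set z \<union> gen_g z ` limit_set z"
proof -
  let ?P = "\<lambda>K. K \<noteq> {} \<and> compact K \<and> K = gen_f z ` K \<union> gen_g z ` K"
  have "K \<subseteq> L" if "?P K" "?P L" for K L
  proof (rule self_covered_subset_invariant[OF assms])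
    show "K \<subseteq> gen_f z ` K \<union> gen_g z ` K" "gen_f z ` L \<union> gen_g z ` L \<subseteq> L" "L \<noteq> {}"
      using that by blast+
    show "bounded K" "closed L"
      using that compact_imp_bounded compact_imp_closed by blast+
  qed
  then have "\<exists>!K. ?P K"
    using exists_self_similar_compact[OF assms] by (metis subset_antisym)
  then have "?P (limit_set z)"
    unfolding limit_set_def by (rule theI')
  then show "limit_set z \<noteq> {}" "compact (limit_set z)"
    "limit_set z = gen_f z ` limit_set z \<union> gen_g z ` limit_set z"
    by blast+
qed

text \<open>The \<open>s\<close>-neighbourhood of \<open>L\<close> is the union of the images, under
  the two generators, of its \<open>s / norm z\<close>-neighbourhood, and these images overlap near
  \<open>p\<close> and \<open>q\<close>. Connectedness thus descends from larger radii, and it is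
  clear once all balls share a point.\<close>

lemma connected_neighbourhood_of_self_similar:
  assumes z: "0 < norm z" "norm z < 1"
    and L: "bounded L" "L = gen_f z ` L \<union> gen_g z ` L"
    and pq: "p \<in> gen_f z ` L" "q \<in> gen_g z ` L" "dist p q < 2 * s"
  shows "connected (\<Union>x\<in>L. ball x s)"
proof -
  obtain x0 where x0: "x0 \<in> L"
    using pq by blast
  obtain R where R: "\<And>y. y \<in> L \<Longrightarrow> dist x0 y \<le> R"
    using L(1) bounded_any_center[of L x0] by auto
  \<comment> \<open>\<open>n\<close> counts the magnifications by \<open>1 / norm z\<close> that
    bring the radius above \<open>R\<close>, where every ball contains \<open>x0\<close>.\<close>
  have *: "connected (\<Union>x\<in>L. ball x s)" if "norm z ^ n * R < s" "dist p q < 2 * s" for n s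
    using that
  proof (induction n arbitrary: s)
    case 0
    have "x0 \<in> ball y s" if "y \<in> L" for y
      using R[OF that] 0 by (simp add: dist_commute)
    then have "x0 \<in> (\<Inter>y\<in>L. ball y s)"
      by blast
    then show ?case
      by (intro connected_Union) (auto simp del: mem_ball)
  next
    case (Suc n)
    define t where "t = s / norm z"
    have st: "s = norm z * t"
      using z by (simp add: t_def)
    have "0 < s"
      using Suc.prems(2) zero_le_dist[of p q] by linarith
    then have "s \<le> t"
      using z by (simp add: t_def field_simps)
    have "norm z ^ n * R < t"
      using Suc.prems(1) z by (simp add: t_def field_simps)
    with \<open>s \<le> t\<close> Suc have conn: "connected (\<Union>x\<in>L. ball x t)"
      by simp
    have z0: "z \<noteq> 0"
      using z by auto
    have ballf: "gen_f z ` ball x t = ball (gen_f z x) s" for x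
      unfolding st by (rule image_ball_of_similarity[OF homeomorphism_gen_f[OF z0] dist_gen_f z(1)])
    have ballg: "gen_g z ` ball x t = ball (gen_g z x) s" for x
      unfolding st by (rule image_ball_of_similarity[OF homeomorphism_gen_g[OF z0] dist_gen_g z(1)])
    have "gen_f z ` (\<Union>x\<in>L. ball x t) = (\<Union>x\<in>gen_f z ` L. ball x s)"
      by (simp add: image_UN ballf)
    then have cf: "connected (\<Union>x\<in>gen_f z ` L. ball x s)"
      using connected_continuous_image[OF continuous_on_gen_f conn] by metis
    have "gen_g z ` (\<Union>x\<in>L. ball x t) = (\<Union>x\<in>gen_g z ` L. ball x s)"
      by (simp add: image_UN ballg)
    then have cg: "connected (\<Union>x\<in>gen_g z ` L. ball x s)"
      using connected_continuous_image[OF continuous_on_gen_g conn] by metis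
    \<comment> \<open>Each distance is half of \<open>dist p q\<close>, hence below
      \<open>s\<close>; this is where the factor 2 in the hypothesis comes from.\<close>
    have "midpoint p q \<in> ball p s" "midpoint p q \<in> ball q s"
      using Suc.prems by (simp_all add: dist_midpoint)
    then have "(\<Union>x\<in>gen_f z ` L. ball x s) \<inter> (\<Union>x\<in>gen_g z ` L. ball x s) \<noteq> {}"
      using pq(1,2) by blast
    then have "connected ((\<Union>x\<in>gen_f z ` L. ball x s) \<union> (\<Union>x\<in>gen_g z ` L. ball x s))"
      by (intro connected_Un cf cg)
    then show ?case
      using L(2) by (metis UN_Un)
  qed
  have "(\<lambda>n. norm z ^ n * R) \<longlonglongrightarrow> 0"
    using z by (intro tendsto_mult_left_zero LIMSEQ_power_zero) auto
  moreover have "0 < s"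
    using pq(3) zero_le_dist[of p q] by linarith
  ultimately have "\<forall>\<^sub>F n in sequentially. norm z ^ n * R < s"
    by (rule order_tendstoD)
  then obtain n where "norm z ^ n * R < s"
    using eventually_happens'[OF sequentially_bot] by blast
  then show ?thesis
    using * pq(3) by blast
qed

text \<open>Two pieces separating the compact set would lie at a positive distance \<open>d\<close>,
  and their \<open>d / 2\<close>-neighbourhoods would separate a neighbourhood.\<close>

lemma connected_if_neighbourhoods_connected:
  fixes L :: "'a::heine_borel set"
  assumes "compact L" "\<And>s. s > 0 \<Longrightarrow> connected (\<Union>x\<in>L. ball x s)"
  shows "connected L"
proof (rule ccontr)
  assume "\<not> connected L"
  then obtain A B where AB: "closed A" "closed B" "A \<noteq> {}" "B \<noteq> {}" "A \<union> B = L" "A \<inter> B = {}"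
    using connected_closed_set[OF compact_imp_closed[OF assms(1)]] by auto
  then have "compact A" 
    by (metis assms(1) compact_Int_closed Un_Int_eq(1) inf_commute)
  then obtain d where d: "d > 0" "\<And>x y. x \<in> A \<Longrightarrow> y \<in> B \<Longrightarrow> d \<le> dist x y"
    using separate_compact_closed[of A B] AB by metis
  define U where "U S = (\<Union>x\<in>S. ball x (d / 2))" for S :: "'a set"
  have "U A \<inter> U B = {}"
  proof (rule ccontr)
    assume "U A \<inter> U B \<noteq> {}"
    then obtain w x y where "x \<in> A" "y \<in> B" "dist x w < d / 2" "dist y w < d / 2"
      by (auto simp: U_def)
    then show False
      using d(2)[of x y] dist_triangle2[of x y w] by linarith
  qed
  moreover have "open (U A)" "open (U B)"
    by (auto simp: U_def)
  moreover have "U A \<noteq> {}" "U B \<noteq> {}"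
    using AB(3,4) d(1) by (auto simp: U_def)
  moreover have "connected (U A \<union> U B)"
    using assms(2)[of "d / 2"] d(1) AB(5) by (simp add: U_def flip: UN_Un)
  ultimately show False
    unfolding connected_def by blast
qed


section \<open>Filling holes\<close>

text \<open>A homeomorphism of the whole space preserves unboundedness of complementary components,
  since closures of bounded sets are compact and have compact images. Hence it maps a filled set
  into the filled image.\<close>

lemma outside_homeomorphic_image_subset:
  fixes h :: "'a::euclidean_space \<Rightarrow> 'a"
  assumes "homeomorphism UNIV UNIV h k"
  shows "outside (h ` S) \<subseteq> h ` outside S"
proof
  fix x assume x: "x \<in> outside (h ` S)"
  define C where "C = connected_component_set (- h ` S) x"
  have hk: "h (k y) = y" and ch: "continuous_on UNIV h" and ck: "continuous_on UNIV k" for y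
    using assms by (auto simp: homeomorphism_def)
  have "\<not> bounded C" "x \<notin> h ` S"
    using x by (auto simp: C_def outside_def)
  then have "x \<in> C"
    by (simp add: C_def connected_component_refl)
  have "\<not> bounded (k ` C)"
  proof
    assume "bounded (k ` C)"
    then have "compact (closure (k ` C))"
      by simp
    then have "compact (h ` closure (k ` C))"
      using ch continuous_on_subset by (blast intro: compact_continuous_image)
    moreover have "C \<subseteq> h ` closure (k ` C)"
      using hk closure_subset[of "k ` C"] by (metis image_eqI subset_iff subsetI)
    ultimately show False
      using \<open>\<not> bounded C\<close> bounded_subset compact_imp_bounded by blast
  qed
  moreover have "k ` C \<subseteq> connected_component_set (- S) (k x)"
  proof (rule connected_component_maximal)
    show "connected (k ` C)"
      unfolding C_def using ck continuous_on_subset by (blast intro: connected_continuous_image)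
    have "C \<subseteq> - h ` S"
      unfolding C_def by (rule connected_component_subset)
    then show "k ` C \<subseteq> - S"
      using hk by (metis ComplD ComplI image_eqI image_subset_iff subsetD)
  qed (use \<open>x \<in> C\<close> in auto)
  ultimately have "k x \<in> outside S"
    unfolding outside using bounded_subset by blast
  then show "x \<in> h ` outside S"
    using hk by (metis imageI)
qed

text \<open>Disjoint connected sets, neither in a hole of the other, lie in each other's outside. A
  point in a hole of both would then have the same complementary component for \<open>A\<close> and
  for \<open>B\<close>, whose nonempty frontier would lie in \<open>A \<inter> B\<close>.\<close>

lemma outside_Un_outside_eq_UNIV:
  fixes A B :: "'a::euclidean_space set"
  assumes "compact A" "connected A" "compact B" "connected B" "A \<inter> B = {}"
    and "\<not> A \<subseteq> inside B" "\<not> B \<subseteq> inside A"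
  shows "outside A \<union> outside B = UNIV"
proof (rule ccontr)
  assume "outside A \<union> outside B \<noteq> UNIV"
  then obtain x where x: "x \<notin> outside A" "x \<notin> outside B"
    by blast
  have sub: "S \<subseteq> outside T" if "connected S" "S \<inter> T = {}" "\<not> S \<subseteq> inside T" for S T :: "'a set"
    using that inside_outside_intersect_connected[of S T] inside_Un_outside[of T] by blast
  have AB: "A \<subseteq> outside B" and BA: "B \<subseteq> outside A"
    using assms sub[of A B] sub[of B A] by auto
  then have xAB: "x \<notin> A" "x \<notin> B"
    using x by auto
  \<comment> \<open>\<open>outside S\<close> is a union of components of \<open>- S\<close>, so a
    component that is not part of it misses \<open>T\<close>.\<close>
  have le: "connected_component_set (- S) x \<subseteq> connected_component_set (- T) x"
    if "T \<subseteq> outside S" "x \<notin> outside S" "x \<notin> S" for S T :: "'a set"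
  proof (rule connected_component_maximal)
    show "connected_component_set (- S) x \<subseteq> - T"
      using that outside_same_component[of S _ x] by (auto dest: connected_component_sym)
  qed (use that in \<open>auto simp: connected_component_refl\<close>)
  define C where "C = connected_component_set (- A) x"
  have "C = connected_component_set (- B) x"
    unfolding C_def using le[OF AB x(2) xAB(2)] le[OF BA x(1) xAB(1)] by blast
  then have "frontier C \<subseteq> A \<inter> B"
    using frontier_of_components_closed_complement[of A C] frontier_of_components_closed_complement[of B C]
      assms(1,3) xAB by (auto simp: C_def components_def compact_imp_closed)
  moreover have "frontier C \<noteq> {}"
  proof (rule frontier_not_empty)
    show "C \<noteq> {}"
      unfolding C_def using xAB(1) connected_component_eq_empty[of "- A" x] by blast
    have "bounded C"
      using x(1) by (simp add: C_def outside)
    then show "C \<noteq> UNIV"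
      by auto
  qed
  ultimately show False
    using assms(5) by auto
qed

text \<open>A point of \<open>A\<close> that is extreme against the direction \<open>c\<close> is
  separated from the translate by a half-space, so it lies outside the translate.\<close>

lemma compact_not_subset_inside_translate:
  fixes A :: "'a::euclidean_space set"
  assumes "compact A" "A \<noteq> {}" "c \<noteq> 0"
  shows "\<not> A \<subseteq> inside ((+) c ` A)"
proof
  assume sub: "A \<subseteq> inside ((+) c ` A)"
  obtain a where a: "a \<in> A" "\<And>y. y \<in> A \<Longrightarrow> c \<bullet> a \<le> c \<bullet> y"
    using continuous_attains_inf[OF assms(1,2), of "\<lambda>y. c \<bullet> y"]
      continuous_on_inner[OF continuous_on_const continuous_on_id] by blast
  let ?T = "{y. c \<bullet> y \<ge> c \<bullet> a + c \<bullet> c}"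
  have "(+) c ` A \<subseteq> ?T"
    using a(2) by (auto simp: inner_add_right)
  then have "- ?T \<subseteq> outside ((+) c ` A)"
    by (intro outside_subset_convex) (auto simp: convex_halfspace_ge)
  moreover have "a \<notin> ?T"
    using assms(3) by (simp flip: inner_gt_zero_iff)
  ultimately show False
    using a(1) sub inside_Int_outside by blast
qed

text \<open>A bounded open plane set is simply connected when it and its complement are connected.
  Here the complement is a single component of \<open>- U\<close>, and removing it from the plane
  leaves a connected set because \<open>U\<close> is connected.\<close>

lemma simply_connected_fill:
  fixes U :: "complex set"
  assumes "open U" "connected U" "bounded U"
  shows "open (- outside U)" "simply_connected (- outside U)"
proof -
  have co: "connected (outside U)" "outside U \<noteq> {}"
    using connected_outside[OF assms(3)] outside_bounded_nonempty[OF assms(3)] by auto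
  then have comp: "outside U \<in> components (- U)"
    by (simp add: outside_in_components)
  then show op: "open (- outside U)"
    using closed_components[of "- U"] assms by (simp add: open_Compl closed_Compl)
  have "connected (- outside U)"
    using component_complement_connected[OF assms(2) comp] .
  then show "simply_connected (- outside U)"
    using simply_connected_iff_simple[OF op] cobounded_outside[OF assms(3)] co by simp
qed

text \<open>The disk is the image of a slightly shrunk round disk under a Riemann map.\<close>

lemma Jordan_disk_between_compact_and_open:
  fixes W :: "complex set"
  assumes "open W" "simply_connected W" "compact C" "C \<subseteq> W" "C \<noteq> {}"
  obtains \<gamma> D where "simple_path \<gamma>" "pathfinish \<gamma> = pathstart \<gamma>"
    "D homeomorphic cball (0::complex) 1" "path_image \<gamma> = frontier D" "C \<subseteq> interior D" "D \<subseteq> W"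
proof -
  have "W homeomorphic ball (0::complex) 1"
    using simply_connected_eq_homeomorphic_to_disc assms by auto
  then obtain h k :: "complex \<Rightarrow> complex" where hom: "homeomorphism W (ball 0 1) h k"
    by (auto simp: homeomorphic_def)
  then have hk: "\<And>x. x \<in> W \<Longrightarrow> k (h x) = x" "\<And>y. y \<in> ball 0 1 \<Longrightarrow> h (k y) = y"
    and im: "h ` W = ball 0 1" "k ` ball 0 1 = W"
    and cont: "continuous_on W h" "continuous_on (ball 0 1) k"
    by (auto simp: homeomorphism_def)
  have hom': "homeomorphism (ball 0 1) W k h"
    using hom homeomorphism_symD by blast
  have "compact (h ` C)" "h ` C \<noteq> {}"
    using assms cont continuous_on_subset by (auto intro!: compact_continuous_image)
  then obtain m where m: "m \<in> h ` C" "\<And>y. y \<in> h ` C \<Longrightarrow> norm y \<le> norm m"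
    using continuous_attains_sup[of "h ` C" norm] by (auto intro: continuous_intros)
  have "norm m < 1"
    using m(1) im(1) assms(4) by force
  then obtain \<rho> where \<rho>: "norm m < \<rho>" "\<rho> < 1"
    using dense by blast
  then have "\<rho> > 0"
    using norm_ge_zero[of m] by linarith
  have sub: "cball 0 \<rho> \<subseteq> ball (0::complex) 1"
    using \<rho> by auto
  define D where "D = k ` cball 0 \<rho>"
  have inj: "inj_on k (ball 0 1)"
    by (metis hk(2) inj_onI)
  have "D \<subseteq> W"
    using sub im(2) by (auto simp: D_def)
  have homD: "homeomorphism (cball 0 \<rho>) D k h"
    unfolding D_def by (rule homeomorphism_of_subsets[OF hom' sub _ refl]) (use sub im(2) in auto)
  have "compact D"
    using homD homeomorphic_compactness homeomorphic_def compact_cball by metis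
  have "openin (top_of_set W) (k ` ball 0 \<rho>)"
    using \<rho> by (intro homeomorphism_imp_open_map[OF hom'] open_subset) auto
  then have "open (k ` ball 0 \<rho>)"
    using assms(1) openin_open_eq by blast
  then have 1: "k ` ball 0 \<rho> \<subseteq> interior D"
    by (intro interior_maximal) (auto simp: D_def)
  \<comment> \<open>\<open>h\<close> sends \<open>interior D\<close> to an open subset of the closed
    disk of radius \<rho>, hence into the open disk. This identifies the interior of
    \<open>D\<close>, and so its frontier as the image of the circle.\<close>
  have "openin (top_of_set (ball 0 1)) (h ` interior D)"
    using \<open>D \<subseteq> W\<close> interior_subset
    by (intro homeomorphism_imp_open_map[OF hom] open_subset) blast+
  then have "open (h ` interior D)"
    using openin_open_eq open_ball by blast
  moreover have "h ` interior D \<subseteq> cball 0 \<rho>"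
    using homeomorphism_image1[OF homeomorphism_symD[OF homD]] interior_subset[of D] by blast
  ultimately have 2: "h ` interior D \<subseteq> ball 0 \<rho>"
    using interior_maximal interior_cball by metis
  have intD: "interior D = k ` ball 0 \<rho>"
  proof
    show "interior D \<subseteq> k ` ball 0 \<rho>"
    proof
      fix x assume x: "x \<in> interior D"
      then have "h x \<in> ball 0 \<rho>" "x = k (h x)"
        using 2 hk(1)[of x] \<open>D \<subseteq> W\<close> interior_subset[of D] by auto
      then show "x \<in> k ` ball 0 \<rho>"
        by (rule rev_image_eqI)
    qed
  qed (rule 1)
  have "frontier D = k ` cball 0 \<rho> - k ` ball 0 \<rho>"
    using \<open>compact D\<close> by (simp add: frontier_def intD compact_imp_closed flip: D_def)
  also have "\<dots> = k ` (cball 0 \<rho> - ball 0 \<rho>)"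
    using sub by (intro inj_on_image_set_diff[OF inj, symmetric]) auto
  also have "\<dots> = k ` sphere 0 \<rho>"
    by (simp add: cball_diff_eq_sphere)
  finally have fr: "frontier D = k ` sphere 0 \<rho>" .
  have sph: "sphere 0 \<rho> \<subseteq> ball (0::complex) 1"
    using \<rho> by auto
  show thesis
  proof
    show "simple_path (k \<circ> circlepath 0 \<rho>)"
      using \<open>\<rho> > 0\<close> sph cont(2) inj
      by (intro simple_path_continuous_image)
        (auto simp: simple_path_circlepath intro: continuous_on_subset inj_on_subset)
    show "pathfinish (k \<circ> circlepath 0 \<rho>) = pathstart (k \<circ> circlepath 0 \<rho>)"
      by (simp add: pathfinish_compose pathstart_compose)
    show "path_image (k \<circ> circlepath 0 \<rho>) = frontier D"
      using \<open>\<rho> > 0\<close> by (simp add: path_image_compose fr)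
    show "D homeomorphic cball (0::complex) 1"
      using homD homeomorphic_balls(2)[of \<rho> 1 0 0] \<open>\<rho> > 0\<close>
      by (meson homeomorphic_def homeomorphic_sym homeomorphic_trans zero_less_one)
    show "C \<subseteq> interior D"
    proof
      fix x assume x: "x \<in> C"
      then have "norm (h x) < \<rho>"
        using m(2)[of "h x"] \<rho>(1) by force
      then show "x \<in> interior D"
        using hk(1)[of x] x assms(4) by (force simp: intD)
    qed
  qed (rule \<open>D \<subseteq> W\<close>)
qed


section \<open>Schottky semigroups\<close>

text \<open>\<open>schottky\<close> speaks of a set of maps and demands disjoint images only for
  different ones; this makes the demand apply to the two generators.\<close>

lemma gen_f_neq_gen_g:
  assumes "z \<noteq> 1"
  shows "gen_f z \<noteq> gen_g z"
proof
  assume "gen_f z = gen_g z"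
  then have "gen_f z 0 = gen_g z 0"
    by simp
  with assms show False
    by (simp add: gen_f_def gen_g_def)
qed

lemma schottky_imp_disconnected_limit_set:
  assumes z: "norm z < 1" and sch: "schottky {gen_f z, gen_g z}"
  shows "\<not> connected (limit_set z)"
proof -
  let ?L = "limit_set z"
  note L = limit_set_properties[OF z]
  obtain D where D: "D homeomorphic cball (0::complex) 1"
    "gen_f z ` D \<subseteq> interior D" "gen_g z ` D \<subseteq> interior D" "gen_f z ` D \<inter> gen_g z ` D = {}"
  proof -
    have "gen_f z \<noteq> gen_g z"
      using z by (intro gen_f_neq_gen_g) auto
    then show thesis
      using sch that unfolding schottky_def by (meson insertI1 insertI2)
  qed
  have cD: "compact D"
    using D(1) homeomorphic_compactness compact_cball by blast
  have "D \<noteq> {}"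
    using D(1) homeomorphic_empty(1) by force
  have "?L \<subseteq> D"
  proof (rule self_covered_subset_invariant[OF z])
    show "?L \<subseteq> gen_f z ` ?L \<union> gen_g z ` ?L"
      using L(3) by blast
    show "gen_f z ` D \<union> gen_g z ` D \<subseteq> D"
      using D(2,3) interior_subset[of D] by blast
    show "bounded ?L" "closed D"
      using L(2) cD compact_imp_bounded compact_imp_closed by blast+
  qed (rule \<open>D \<noteq> {}\<close>)
  then have sub: "gen_f z ` ?L \<subseteq> gen_f z ` D" "gen_g z ` ?L \<subseteq> gen_g z ` D"
    by auto
  have cl: "closed (gen_f z ` D)" "closed (gen_g z ` D)"
    using cD by (auto intro!: compact_imp_closed compact_continuous_image
        continuous_on_gen_f continuous_on_gen_g)
  show ?thesis
  proof
    assume "connected ?L"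
    moreover have "?L \<subseteq> gen_f z ` D \<union> gen_g z ` D"
      using L(3) sub by blast
    moreover have "gen_f z ` D \<inter> ?L \<noteq> {}" "gen_g z ` D \<inter> ?L \<noteq> {}"
      using L(1,3) sub by blast+
    ultimately show False
      using D(4) cl unfolding connected_closed by blast
  qed
qed

lemma disconnected_limit_set_imp_schottky:
  assumes z: "0 < norm z" "norm z < 1" and dis: "\<not> connected (limit_set z)"
  shows "schottky {gen_f z, gen_g z}"
proof -
  define L where "L = limit_set z"
  have L: "L \<noteq> {}" "compact L" "L = gen_f z ` L \<union> gen_g z ` L"
    using limit_set_properties[OF z(2)] by (simp_all add: L_def)
  have bL: "bounded L"
    using L(2) compact_imp_bounded by blast
  have cfg: "compact (gen_f z ` L)" "compact (gen_g z ` L)"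
    using L(2) by (auto intro!: compact_continuous_image continuous_on_gen_f continuous_on_gen_g)
  define \<delta> where "\<delta> = setdist (gen_f z ` L) (gen_g z ` L)"
  obtain p q where pq: "p \<in> gen_f z ` L" "q \<in> gen_g z ` L" "dist p q = \<delta>"
    using setdist_compact_closed[OF cfg(1) compact_imp_closed[OF cfg(2)]] L(1)
    unfolding \<delta>_def by blast
  have conn: "connected (\<Union>x\<in>L. ball x s)" if "\<delta> < 2 * s" for s
    using connected_neighbourhood_of_self_similar[OF z bL L(3) pq(1,2)] pq(3) that by simp
  \<comment> \<open>For \<delta> = 0 all neighbourhoods would be connected, and so would
    \<open>L\<close>.\<close>
  have "\<delta> \<noteq> 0"
    using connected_if_neighbourhoods_connected[OF L(2)] conn dis by (auto simp: L_def)
  then have "\<delta> > 0"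
    using pq(3) zero_le_dist[of p q] by linarith
  then have "\<delta> / 2 < \<delta> / (2 * norm z)"
    using z by (simp add: field_simps)
  \<comment> \<open>The lower bound makes \<open>U\<close> connected; the upper bound keeps its
    images apart.\<close>
  then obtain r where r: "\<delta> / 2 < r" "r < \<delta> / (2 * norm z)"
    using dense by blast
  have "r > 0" and r2: "2 * (norm z * r) < \<delta>"
    using r \<open>\<delta> > 0\<close> z by (simp_all add: field_simps)
  define U where "U = (\<Union>x\<in>L. ball x r)"
  have U: "open U" "connected U"
    using conn[of r] r by (auto simp: U_def)
  define K where "K = closure U"
  have Ksub: "K \<subseteq> (\<Union>x\<in>L. cball x r)"
    unfolding K_def
    by (rule closure_minimal)
      (use compact_minkowski_sum_cball[OF L(2)] in \<open>auto simp: U_def compact_imp_closed intro: less_imp_le\<close>)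
  have "bounded U"
    using Ksub closure_subset[of U] compact_imp_bounded[OF compact_minkowski_sum_cball[OF L(2)]]
    unfolding K_def by (meson bounded_subset)
  have K: "compact K" "connected K" "K \<noteq> {}"
    using \<open>bounded U\<close> U(2) L(1) \<open>r > 0\<close> unfolding K_def
    by (auto intro: connected_imp_connected_closure simp: U_def)
  have "norm z * r < r"
    using \<open>r > 0\<close> z by simp
  \<comment> \<open>The generators shrink the distance \<open>r\<close> to
    \<open>norm z * r\<close>. This is below \<open>r\<close>, so the images of \<open>K\<close>
    stay in \<open>U\<close>, and its double is below \<delta>, so they are disjoint.\<close>
  have near: "\<exists>y\<in>L. dist (gen_f z y) (gen_f z x) \<le> norm z * r \<and>
                    dist (gen_g z y) (gen_g z x) \<le> norm z * r" if "x \<in> K" for x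
    using Ksub that z by (fastforce simp: dist_gen_f dist_gen_g)
  have in_U: "gen_f z ` K \<subseteq> U" "gen_g z ` K \<subseteq> U"
  proof -
    have "gen_f z x \<in> U \<and> gen_g z x \<in> U" if x: "x \<in> K" for x
    proof -
      obtain y where "y \<in> L" "gen_f z x \<in> ball (gen_f z y) r" "gen_g z x \<in> ball (gen_g z y) r"
        using near[OF x] \<open>norm z * r < r\<close> by (auto intro: order_le_less_trans)
      moreover have "gen_f z y \<in> L" "gen_g z y \<in> L"
        using L(3) \<open>y \<in> L\<close> by blast+
      ultimately show ?thesis
        unfolding U_def by blast
    qed
    then show "gen_f z ` K \<subseteq> U" "gen_g z ` K \<subseteq> U"
      by blast+
  qed
  have disj: "gen_f z ` K \<inter> gen_g z ` K = {}"
  proof (rule ccontr)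
    assume "gen_f z ` K \<inter> gen_g z ` K \<noteq> {}"
    then obtain w x y where w: "w = gen_f z x" "w = gen_g z y" "x \<in> K" "y \<in> K"
      by blast
    obtain x' where x': "x' \<in> L" "dist (gen_f z x') w \<le> norm z * r"
      unfolding w(1) using near[OF w(3)] by blast
    obtain y' where y': "y' \<in> L" "dist (gen_g z y') w \<le> norm z * r"
      unfolding w(2) using near[OF w(4)] by blast
    have "\<delta> \<le> dist (gen_f z x') (gen_g z y')"
      using x'(1) y'(1) unfolding \<delta>_def by (intro setdist_le_dist) auto
    then show False
      using x'(2) y'(2) r2 dist_triangle2[of "gen_f z x'" "gen_g z y'" w] by linarith
  qed
  have cK: "compact (gen_f z ` K)" "connected (gen_f z ` K)"
    "compact (gen_g z ` K)" "connected (gen_g z ` K)"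
    using K by (auto intro!: compact_continuous_image connected_continuous_image
        continuous_on_gen_f continuous_on_gen_g)
  have "1 - z \<noteq> 0"
    using z by auto
  have gK: "gen_g z ` K = (+) (1 - z) ` gen_f z ` K"
    by (simp add: image_image gen_g_eq)
  then have fK: "gen_f z ` K = (+) (- (1 - z)) ` gen_g z ` K"
    by (simp add: image_image)
  have out: "outside (gen_f z ` K) \<union> outside (gen_g z ` K) = UNIV"
  proof (rule outside_Un_outside_eq_UNIV[OF cK disj])
    show "\<not> gen_f z ` K \<subseteq> inside (gen_g z ` K)"
      unfolding gK using \<open>1 - z \<noteq> 0\<close> cK K(3)
      by (intro compact_not_subset_inside_translate) auto
    have "\<not> gen_g z ` K \<subseteq> inside ((+) (- (1 - z)) ` gen_g z ` K)"
      using \<open>1 - z \<noteq> 0\<close> cK K(3) by (intro compact_not_subset_inside_translate) auto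
    then show "\<not> gen_g z ` K \<subseteq> inside (gen_f z ` K)"
      unfolding fK .
  qed
  \<comment> \<open>The compact filling \<open>V\<close> is what the generators act on, and the open
    filling \<open>W\<close> carries the Riemann map. The disk is sandwiched: the images of
    \<open>V\<close> lie in \<open>interior D\<close>, and
    \<open>D \<subseteq> W \<subseteq> V\<close>.\<close>
  define V where "V = - outside K"
  define W where "W = - outside U"
  have W: "open W" "simply_connected W"
    using simply_connected_fill[OF U \<open>bounded U\<close>] by (simp_all add: W_def)
  have "W \<subseteq> V"
    using outside_mono[of U K] closure_subset[of U] by (auto simp: W_def V_def K_def)
  have "closed V" "bounded V"
    unfolding V_def using K(1)
    by (auto simp: open_outside compact_imp_closed compact_imp_bounded cobounded_outside)
  then have "compact V"
    by (simp add: compact_eq_bounded_closed)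
  have z0: "z \<noteq> 0"
    using z by auto
  have imV: "h ` V \<subseteq> - outside (h ` K)" if "homeomorphism UNIV UNIV h k" for h k :: "complex \<Rightarrow> complex"
  proof -
    have "inj h"
      using that by (metis UNIV_I homeomorphism_apply1 injI)
    then show ?thesis
      using outside_homeomorphic_image_subset[OF that, of K] by (auto simp: V_def inj_eq)
  qed
  have fV: "gen_f z ` V \<subseteq> - outside (gen_f z ` K)"
    by (rule imV[OF homeomorphism_gen_f[OF z0]])
  have gV: "gen_g z ` V \<subseteq> - outside (gen_g z ` K)"
    by (rule imV[OF homeomorphism_gen_g[OF z0]])
  \<comment> \<open>Filling holes is monotone, and the images of \<open>K\<close> lie in
    \<open>U\<close>.\<close>
  have VW: "gen_f z ` V \<union> gen_g z ` V \<subseteq> W"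
    using fV gV outside_mono[OF in_U(1)] outside_mono[OF in_U(2)] unfolding W_def by blast
  have "U \<subseteq> V"
    using closure_subset[of U] outside_no_overlap[of K] unfolding V_def K_def by blast
  then have "V \<noteq> {}"
    using L(1) \<open>r > 0\<close> by (auto simp: U_def)
  have "compact (gen_f z ` V \<union> gen_g z ` V)"
    using \<open>compact V\<close> by (auto intro!: compact_Un compact_continuous_image
        continuous_on_gen_f continuous_on_gen_g)
  then obtain \<gamma> D where D: "simple_path \<gamma>" "pathfinish \<gamma> = pathstart \<gamma>"
    "D homeomorphic cball (0::complex) 1" "path_image \<gamma> = frontier D"
    "gen_f z ` V \<union> gen_g z ` V \<subseteq> interior D" "D \<subseteq> W"
    using Jordan_disk_between_compact_and_open[OF W _ VW] \<open>V \<noteq> {}\<close> by auto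
  have "D \<subseteq> V"
    using D(6) \<open>W \<subseteq> V\<close> by blast
  then have "gen_f z ` D \<subseteq> interior D" "gen_g z ` D \<subseteq> interior D"
    using D(5) by blast+
  \<comment> \<open>By \<open>out\<close> no point belongs to both filled images.\<close>
  moreover have "gen_f z ` D \<inter> gen_g z ` D = {}"
    using \<open>D \<subseteq> V\<close> fV gV out by blast
  ultimately show ?thesis
    unfolding schottky_def using D(1-4) by (intro exI[of _ \<gamma>] exI[of _ D]) auto
qed

theorem theorem5p2p3:
  fixes z :: complex
  assumes "0 < norm z" and "norm z < 1"
  shows "\<not> connected (limit_set z) \<longleftrightarrow> schottky {gen_f z, gen_g z}"
  using disconnected_limit_set_imp_schottky schottky_imp_disconnected_limit_set assms by blast

end
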